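(* Let $\mathbb F$ be a field. The following (i), (ii) hold for every integer $d\geq 1$. (i) Assume that ${\rm Char}(\mathbb F)\neq d+1$. Then circular bidiagonal pairs ${\rm CBP}(\mathbb F;d,q,\varepsilon)$ and ${\rm CBP}(\mathbb F;d,q',\varepsilon')$ are affine equivalent if and only if both $$q=q',\qquad \varepsilon'\in\{\varepsilon,q\varepsilon,q^2\varepsilon,\ldots,q^d\varepsilon\}.$$ (ii) Assume that ${\rm Char}(\mathbb F)=d+1$. Then circular bidiagonal pairs ${\rm CBP}(\mathbb F;d,\gamma)$ and ${\rm CBP}(\mathbb F;d,\gamma')$ are affine equivalent if and only if $$\gamma'-\gamma\in\{0,1,2,\ldots,d\}.$$
   Context: Matrices in ${\rm Mat}_{d+1}(\mathbb F)$ have rows and columns indexed by $0,1,\ldots,d$ and act on column vectors $\mathbb F^{d+1}$ by left multiplication. For $d\ge 1$, a matrix in ${\rm Mat}_{d+1}(\mathbb F)$ is circular bidiagonal whenever (i) each nonzero entry is on the diagonal, or the subdiagonal (entries $(i,i-1)$, $1\le i\le d$), or in the top-right corner (entry $(0,d)$); (ii) each subdiagonal entry is nonzero and the top-right corner entry is nonzero. A circular bidiagonal pair on a $(d+1)$-dimensional vector space $V$ over $\mathbb F$ is an ordered pair of $\mathbb F$-linear maps $A:V\to V$, $A^*:V\to V$ such that (i) there exists a basis for $V$ with respect to which the matrix representing $A$ is circular bidiagonal and the matrix representing $A^*$ is diagonal; (ii) there exists a basis for $V$ with respect to which the matrix representing $A^*$ is circular bidiagonal and the matrix representing $A$ is diagonal.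 (A matrix $X$ represents $A$ with respect to $\{v_i\}_{i=0}^d$ whenever $Av_j=\sum_i X_{i,j}v_i$ for all $j$.) Isomorphism: circular bidiagonal pairs $A,A^*$ on $V$ and $B,B^*$ on $\mathcal V$ are isomorphic whenever there exists a vector space isomorphism $\sigma:V\to\mathcal V$ with $\sigma A=B\sigma$ and $\sigma A^*=B^*\sigma$. For $s,s^*,t,t^*\in\mathbb F$ with $s,s^*$ nonzero, the circular bidiagonal pair $sA+tI,\ s^*A^*+t^*I$ is called an affine transformation of $A,A^*$. Two circular bidiagonal pairs are affine equivalent whenever some affine transformation of the first is isomorphic to the second. ${\rm CBP}(\mathbb F;d,q,\varepsilon)$: here $q\in\mathbb F$ is a primitive $(d+1)^{\rm th}$ root of unity and $\varepsilon\in\mathbb F$ is not among $1,q,\ldots,q^d$ (and likewise for $q',\varepsilon'$). It is the circular bidiagonal pair $A,A^*$ on $\mathbb F^{d+1}$ where $A_{i,i}=q^{-i}\varepsilon$ $(0\le i\le d)$, $A_{0,d}=1-\varepsilon$, $A_{i,i-1}=1-q^{-i}\varepsilon$ $(1\le i\le d)$, all other entries of $A$ are zero, and $A^*={\rm diag}(1,q,q^2,\ldots,q^d)$. ${\rm CBP}(\mathbb F;d,\gamma)$: here $d+1$ is prime, ${\rm Char}(\mathbb F)=d+1$, and $\gamma\in\mathbb F$ is not among $0,1,\ldots,d$ (and likewise for $\gamma'$). It is the circular bidiagonal pair $A,A^*$ on $\mathbb F^{d+1}$ where $A_{i,i}=i+\gamma$ $(0\le i\le d)$, $A_{0,d}=-\gamma$,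 $A_{i,i-1}=-i-\gamma$ $(1\le i\le d)$, all other entries of $A$ are zero, and $A^*={\rm diag}(0,1,2,\ldots,d)$. *)

theory Defs
  imports "Jordan_Normal_Form.VS_Connect"
begin

definition circular_bidiagonal_mat :: "nat \<Rightarrow> 'a::field mat \<Rightarrow> bool" where
  "circular_bidiagonal_mat d X \<longleftrightarrow>
     d \<ge> 1 \<and> X \<in> carrier_mat (d + 1) (d + 1) \<and>
     (\<forall>i\<le>d. \<forall>j\<le>d. X $$ (i, j) \<noteq> 0 \<longrightarrow> i = j \<or> i = j + 1 \<or> (i = 0 \<and> j = d)) \<and>
     (\<forall>i\<in>{1..d}. X $$ (i, i - 1) \<noteq> 0) \<and> X $$ (0, d) \<noteq> 0"

text \<open>Vector spaces over \<open>'a\<close> are \<open>vectorspace class_ring V\<close>, with an explicit carrier, so that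
  the dimension can be a term. Linear maps are functions whose values matter on the carrier only.\<close>

definition ordered_basis :: "('a::field, 'v) module \<Rightarrow> nat \<Rightarrow> (nat \<Rightarrow> 'v) \<Rightarrow> bool" where
  "ordered_basis V d v \<longleftrightarrow>
     inj_on v {0..d} \<and> vectorspace.basis class_ring V (v ` {0..d})"

definition represents ::
    "('a::field, 'v) module \<Rightarrow> nat \<Rightarrow> (nat \<Rightarrow> 'v) \<Rightarrow> 'a mat \<Rightarrow> ('v \<Rightarrow> 'v) \<Rightarrow> bool" where
  "represents V d v X A \<longleftrightarrow>
     X \<in> carrier_mat (d + 1) (d + 1) \<and>
     (\<forall>j\<le>d. A (v j) = (\<Oplus>\<^bsub>V\<^esub>i\<in>{0..d}. X $$ (i, j) \<odot>\<^bsub>V\<^esub> v i))"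

definition circular_bidiagonal_pair ::
    "('a::field, 'v) module \<Rightarrow> nat \<Rightarrow> ('v \<Rightarrow> 'v) \<Rightarrow> ('v \<Rightarrow> 'v) \<Rightarrow> bool" where
  "circular_bidiagonal_pair V d A As \<longleftrightarrow>
     linear_map class_ring V V A \<and> linear_map class_ring V V As \<and>
     (\<exists>v X D. ordered_basis V d v \<and>
        represents V d v X A \<and> circular_bidiagonal_mat d X \<and>
        represents V d v D As \<and> diagonal_mat D) \<and>
     (\<exists>v X D. ordered_basis V d v \<and>
        represents V d v X As \<and> circular_bidiagonal_mat d X \<and>
        represents V d v D A \<and> diagonal_mat D)"

definition isomorphic_pairs ::
    "('a::field, 'v) module \<Rightarrow> ('v \<Rightarrow> 'v) \<Rightarrow> ('v \<Rightarrow> 'v) \<Rightarrow>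
     ('a, 'w) module \<Rightarrow> ('w \<Rightarrow> 'w) \<Rightarrow> ('w \<Rightarrow> 'w) \<Rightarrow> bool" where
  "isomorphic_pairs V A As W B Bs \<longleftrightarrow>
     (\<exists>\<sigma>. linear_map class_ring V W \<sigma> \<and> bij_betw \<sigma> (carrier V) (carrier W) \<and>
        (\<forall>v\<in>carrier V. \<sigma> (A v) = B (\<sigma> v)) \<and> (\<forall>v\<in>carrier V. \<sigma> (As v) = Bs (\<sigma> v)))"

definition affine_map ::
    "('a::field, 'v) module \<Rightarrow> 'a \<Rightarrow> 'a \<Rightarrow> ('v \<Rightarrow> 'v) \<Rightarrow> 'v \<Rightarrow> 'v" where
  "affine_map V s t A = (\<lambda>v. s \<odot>\<^bsub>V\<^esub> A v \<oplus>\<^bsub>V\<^esub> t \<odot>\<^bsub>V\<^esub> v)"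

definition affine_equivalent ::
    "nat \<Rightarrow> ('a::field, 'v) module \<Rightarrow> ('v \<Rightarrow> 'v) \<Rightarrow> ('v \<Rightarrow> 'v) \<Rightarrow>
     ('a, 'w) module \<Rightarrow> ('w \<Rightarrow> 'w) \<Rightarrow> ('w \<Rightarrow> 'w) \<Rightarrow> bool" where
  "affine_equivalent d V A As W B Bs \<longleftrightarrow>
     circular_bidiagonal_pair V d A As \<and> circular_bidiagonal_pair W d B Bs \<and>
     (\<exists>s t ss ts. s \<noteq> 0 \<and> ss \<noteq> 0 \<and>
        isomorphic_pairs V (affine_map V s t A) (affine_map V ss ts As) W B Bs)"

text \<open>For pairs of matrices in \<open>Mat\<^bsub>d+1\<^esub>\<close>, acting on column vectors by left multiplication.\<close>

definition mat_affine_equivalent ::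
    "nat \<Rightarrow> 'a::field mat \<times> 'a mat \<Rightarrow> 'a mat \<times> 'a mat \<Rightarrow> bool" where
  "mat_affine_equivalent d P Q \<longleftrightarrow>
     affine_equivalent d
       (module_vec TYPE('a) (d + 1)) (\<lambda>v. fst P *\<^sub>v v) (\<lambda>v. snd P *\<^sub>v v)
       (module_vec TYPE('a) (d + 1)) (\<lambda>v. fst Q *\<^sub>v v) (\<lambda>v. snd Q *\<^sub>v v)"

definition primitive_root_of_unity :: "nat \<Rightarrow> 'a::field \<Rightarrow> bool" where
  "primitive_root_of_unity n q \<longleftrightarrow> n > 0 \<and> q ^ n = 1 \<and> (\<forall>k. 0 < k \<and> k < n \<longrightarrow> q ^ k \<noteq> 1)"

definition CBP_root :: "nat \<Rightarrow> 'a::field \<Rightarrow> 'a \<Rightarrow> 'a mat \<times> 'a mat" where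
  "CBP_root d q \<epsilon> =
     (mat (d + 1) (d + 1) (\<lambda>(i, j).
        if i = j then inverse (q ^ i) * \<epsilon>
        else if i = 0 \<and> j = d then 1 - \<epsilon>
        else if i = j + 1 then 1 - inverse (q ^ i) * \<epsilon>
        else 0),
      mat (d + 1) (d + 1) (\<lambda>(i, j). if i = j then q ^ i else 0))"

definition CBP_char :: "nat \<Rightarrow> 'a::field \<Rightarrow> 'a mat \<times> 'a mat" where
  "CBP_char d \<gamma> =
     (mat (d + 1) (d + 1) (\<lambda>(i, j).
        if i = j then of_nat i + \<gamma>
        else if i = 0 \<and> j = d then - \<gamma>
        else if i = j + 1 then - of_nat i - \<gamma>
        else 0),
      mat (d + 1) (d + 1) (\<lambda>(i, j). if i = j then of_nat i else 0))"

end

(* Let S be the cyclic shift. In both families A = lambda_0 S + a (1 - S) with a and A^* diagonal, so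
   the all-ones vector is an eigenvector of A, and a linear relation between A A^*, A^* A, A, A^* and 1
   shows that A^* - c_k moves eigenvectors of A for lambda_k to eigenvectors for lambda_(k+1). The
   resulting eigenbasis makes A^* circular bidiagonal. Conjugation by powers of S gives the affine
   equivalences. Conversely, an affine equivalence carries the relation of one pair to that of
   the other, and comparing entries determines the scalars s, t, s^*, t^* up to the requirement that
   the spectra match. *)

theory Submission
  imports Defs "HOL-Number_Theory.Cong"
begin

text \<open>The root family satisfies \<open>q A As - As A = (q - 1) \<epsilon> I\<close>, the other
  one \<open>As A - A As - A + As + \<gamma> I = 0\<close>. Transporting these relations leaves one
  quantity free: the product \<open>s * ss\<close>, with
  \<open>\<epsilon>' = s * ss * \<epsilon>\<close>, in the first case, and the difference
  \<open>t - ts = \<gamma>' - \<gamma>\<close> in the second. The relation puts no further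
  restriction on it; that each affine map must carry an eigenvalue to an eigenvalue cuts it down to
  a power of \<open>q\<close>, or to an element of the prime field. Affine equivalence also demands
  that both pairs be circular bidiagonal, so the second basis has to be constructed even for the
  direction that only needs a conjugation. Indices are taken on a cycle:
  \<open>(i + d) mod Suc d\<close> is the predecessor of \<open>i\<close>, so the top-right corner
  is an ordinary neighbour entry and row computations need no boundary case. The neighbour entry is
  \<open>e - a i\<close>, so that every row sums to \<open>e\<close>.\<close>

definition circ_mat :: "nat \<Rightarrow> (nat \<Rightarrow> 'a::field) \<Rightarrow> 'a \<Rightarrow> 'a mat" where
  "circ_mat d a e = mat (d + 1) (d + 1) (\<lambda>(i, j).
     if i = j then a i else if j = (i + d) mod Suc d then e - a i else 0)"

definition diag_seq_mat :: "nat \<Rightarrow> (nat \<Rightarrow> 'a::field) \<Rightarrow> 'a mat" where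
  "diag_seq_mat d \<theta> = mat (d + 1) (d + 1) (\<lambda>(i, j). if i = j then \<theta> i else 0)"

lemma circ_mat_carrier [simp]: "circ_mat d a e \<in> carrier_mat (Suc d) (Suc d)"
  and diag_seq_mat_carrier [simp]: "diag_seq_mat d \<theta> \<in> carrier_mat (Suc d) (Suc d)"
  by (simp_all add: circ_mat_def diag_seq_mat_def)

lemma circ_mat_dims [simp]:
  "dim_row (circ_mat d a e) = Suc d" "dim_col (circ_mat d a e) = Suc d"
  "dim_row (diag_seq_mat d \<theta>) = Suc d" "dim_col (diag_seq_mat d \<theta>) = Suc d"
  by (simp_all add: circ_mat_def diag_seq_mat_def)

lemma pred_le [simp]: "(i + d) mod Suc d \<le> d"
  using mod_less_divisor[of "Suc d"] by (simp add: less_Suc_eq_le)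

lemma pred_mod:
  assumes "i \<le> d" shows "(i + d) mod Suc d = (if i = 0 then d else i - 1)"
proof (cases i)
  case (Suc j)
  then have "(i + d) mod Suc d = (j + Suc d) mod Suc d" by simp
  also have "\<dots> = j" using Suc assms by (simp only: mod_add_self2) simp
  finally show ?thesis using Suc by simp
qed simp

lemma pred_mod_neq: "1 \<le> d \<Longrightarrow> i \<le> d \<Longrightarrow> (i + d) mod Suc d \<noteq> i"
  by (subst pred_mod) auto

lemma mult_mat_vec_index_sum:
  assumes "M \<in> carrier_mat (Suc d) (Suc d)" "w \<in> carrier_vec (Suc d)" "i \<le> d"
  shows "(M *\<^sub>v w) $ i = (\<Sum>j\<in>{0..<Suc d}. M $$ (i, j) * w $ j)"
  using assms by (auto simp: scalar_prod_def intro!: sum.cong simp del: sum.op_ivl_Suc)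

lemma circ_mat_mult_index:
  assumes "1 \<le> d" "w \<in> carrier_vec (Suc d)" "i \<le> d"
  shows "(circ_mat d a e *\<^sub>v w) $ i = a i * w $ i + (e - a i) * w $ ((i + d) mod Suc d)"
proof -
  let ?p = "(i + d) mod Suc d"
  have ne: "?p \<noteq> i" using pred_mod_neq[OF assms(1,3)] .
  have "(circ_mat d a e *\<^sub>v w) $ i =
      (\<Sum>j\<in>{0..<Suc d}. (if j = i then a i * w $ i else 0) + (if j = ?p then (e - a i) * w $ ?p else 0))"
    unfolding mult_mat_vec_index_sum[OF circ_mat_carrier assms(2,3)]
    using assms ne by (intro sum.cong) (auto simp: circ_mat_def)
  also have "\<dots> = a i * w $ i + (e - a i) * w $ ?p"
    using assms by (simp add: sum.distrib del: sum.op_ivl_Suc)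
  finally show ?thesis .
qed

lemma diag_seq_mat_mult_index:
  assumes "w \<in> carrier_vec (Suc d)" "i \<le> d"
  shows "(diag_seq_mat d \<theta> *\<^sub>v w) $ i = \<theta> i * w $ i"
proof -
  have "(diag_seq_mat d \<theta> *\<^sub>v w) $ i = (\<Sum>j\<in>{0..<Suc d}. if j = i then \<theta> i * w $ i else 0)"
    unfolding mult_mat_vec_index_sum[OF diag_seq_mat_carrier assms]
    using assms by (intro sum.cong) (auto simp: diag_seq_mat_def)
  then show ?thesis using assms by (simp del: sum.op_ivl_Suc)
qed

section \<open>Bases and representing matrices for column vectors\<close>

lemma linear_map_mult_mat_vec:
  assumes "M \<in> carrier_mat n n"
  shows "linear_map class_ring (module_vec TYPE('a::field) n) (module_vec TYPE('a) n) (\<lambda>v. M *\<^sub>v v)"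
  unfolding linear_map_def mod_hom_def mod_hom_axioms_def LinearCombinations.module_hom_def
  using assms vec_vs vec_module
  by (auto simp: module_vec_simps mult_add_distrib_mat_vec mult_mat_vec)

text \<open>In dimension \<open>d + 1\<close>, independence of \<open>d + 1\<close> vectors is
  enough. It is assumed for the indexed family rather than for its image, so that it also yields
  injectivity of the enumeration.\<close>

lemma ordered_basis_vecI:
  fixes u :: "nat \<Rightarrow> 'a::field vec"
  assumes carr: "\<And>k. k \<le> d \<Longrightarrow> u k \<in> carrier_vec (Suc d)"
    and indep: "\<And>b. (\<And>i. i \<le> d \<Longrightarrow> (\<Sum>k\<le>d. b k * u k $ i) = 0) \<Longrightarrow> \<forall>k\<le>d. b k = 0"
  shows "ordered_basis (module_vec TYPE('a) (d + 1)) d u"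
proof -
  interpret vec_space "TYPE('a)" "Suc d" .
  have inj: "inj_on u {0..d}"
  proof (rule inj_onI, rule ccontr)
    fix x y assume xy: "x \<in> {0..d}" "y \<in> {0..d}" "u x = u y" "x \<noteq> y"
    \<comment> \<open>The coefficients of \<open>u x - u y\<close>, a nontrivial combination that
      would vanish.\<close>
    let ?b = "\<lambda>k. if k = x then 1 else if k = y then - 1 else (0::'a)"
    have "(\<Sum>k\<le>d. ?b k * u k $ i) = 0" for i
    proof -
      have "(\<Sum>k\<le>d. ?b k * u k $ i) =
        (\<Sum>k\<le>d. (if k = x then u x $ i else 0) - (if k = y then u y $ i else 0))"
        using xy(4) by (intro sum.cong refl) simp
      also have "\<dots> = u x $ i - u y $ i" using xy(1,2) by (simp add: sum_subtractf)
      finally show ?thesis unfolding xy(3) by simp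
    qed
    then have "\<forall>k\<le>d. ?b k = 0" by (rule indep)
    then have "?b x = 0" using xy(1) by (simp only: atLeastAtMost_iff)
    then show False by simp
  qed
  have sub: "u ` {0..d} \<subseteq> carrier_vec (Suc d)" using carr by auto
  have "lin_indpt (u ` {0..d})"
  proof (rule finite_lin_indpt2)
    fix b assume lc: "lincomb b (u ` {0..d}) = 0\<^sub>v (Suc d)"
    have "(\<Sum>k\<le>d. b (u k) * u k $ i) = 0" if i: "i \<le> d" for i
    proof -
      have "lincomb b (u ` {0..d}) $ i = (\<Sum>x\<in>u ` {0..d}. b x * x $ i)"
        using i by (intro lincomb_index sub) auto
      also have "\<dots> = (\<Sum>k\<in>{0..d}. b (u k) * u k $ i)"
        by (simp add: sum.reindex[OF inj])
      finally show ?thesis using lc i by (simp add: atMost_atLeast0)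
    qed
    from indep[of "\<lambda>k. b (u k)", OF this] show "\<forall>v\<in>u ` {0..d}. b v = 0" by auto
  qed (use sub in auto)
  moreover have "card (u ` {0..d}) = Suc d" using card_image[OF inj] by simp
  ultimately have "basis (u ` {0..d})"
    using sub dim_is_n by (intro dim_li_is_basis) auto
  then show ?thesis using inj by (simp add: ordered_basis_def)
qed

lemma ordered_basis_vec_expand:
  fixes w :: "'a::field vec"
  assumes "ordered_basis (module_vec TYPE('a) (d + 1)) d u" "w \<in> carrier_vec (Suc d)"
  obtains b where "\<And>i. i \<le> d \<Longrightarrow> w $ i = (\<Sum>k\<le>d. b k * u k $ i)"
proof -
  interpret vec_space "TYPE('a)" "Suc d" .
  have inj: "inj_on u {0..d}" and bas: "basis (u ` {0..d})"
    using assms by (auto simp: ordered_basis_def)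
  then have sub: "u ` {0..d} \<subseteq> carrier_vec (Suc d)" and "span (u ` {0..d}) = carrier_vec (Suc d)"
    by (auto simp: basis_def)
  then obtain b where b: "lincomb b (u ` {0..d}) = w"
    using finite_in_span[of "u ` {0..d}" w] assms by auto
  show thesis
  proof (rule that[of "\<lambda>k. b (u k)"])
    fix i assume "i \<le> d"
    then have "w $ i = (\<Sum>x\<in>u ` {0..d}. b x * x $ i)"
      unfolding b[symmetric] by (intro lincomb_index sub) auto
    then show "w $ i = (\<Sum>k\<le>d. b (u k) * u k $ i)"
      by (simp add: sum.reindex[OF inj] atMost_atLeast0)
  qed
qed

lemma represents_vecI:
  fixes u :: "nat \<Rightarrow> 'a::field vec"
  assumes "X \<in> carrier_mat (Suc d) (Suc d)" "M \<in> carrier_mat (Suc d) (Suc d)"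
    and carr: "\<And>k. k \<le> d \<Longrightarrow> u k \<in> carrier_vec (Suc d)"
    and eq: "\<And>i j. i \<le> d \<Longrightarrow> j \<le> d \<Longrightarrow> (M *\<^sub>v u j) $ i = (\<Sum>k\<le>d. X $$ (k, j) * u k $ i)"
  shows "represents (module_vec TYPE('a) (d + 1)) d u X (\<lambda>v. M *\<^sub>v v)"
proof -
  interpret vec_space "TYPE('a)" "Suc d" .
  have "M *\<^sub>v u j = (\<Oplus>\<^bsub>V\<^esub>k\<in>{0..d}. X $$ (k, j) \<cdot>\<^sub>v u k)" if j: "j \<le> d" for j
  proof (rule eq_vecI)
    have f: "(\<lambda>k. X $$ (k, j) \<cdot>\<^sub>v u k) \<in> {0..d} \<rightarrow> carrier_vec (Suc d)" using carr by auto
    show dim: "dim_vec (M *\<^sub>v u j) = dim_vec (\<Oplus>\<^bsub>V\<^esub>k\<in>{0..d}. X $$ (k, j) \<cdot>\<^sub>v u k)"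
      using finsum_dim[OF finite_atLeastAtMost f] assms(2) by (metis dim_mult_mat_vec carrier_matD(1))
    fix i assume "i < dim_vec (\<Oplus>\<^bsub>V\<^esub>k\<in>{0..d}. X $$ (k, j) \<cdot>\<^sub>v u k)"
    then have i: "i < Suc d" using dim assms by simp
    have "(\<Oplus>\<^bsub>V\<^esub>k\<in>{0..d}. X $$ (k, j) \<cdot>\<^sub>v u k) $ i = (\<Sum>k\<in>{0..d}. (X $$ (k, j) \<cdot>\<^sub>v u k) $ i)"
      using index_finsum_vec[OF _ i f] by simp
    also have "\<dots> = (\<Sum>k\<in>{0..d}. X $$ (k, j) * u k $ i)"
      using carr i by (intro sum.cong refl index_smult_vec) (metis atLeastAtMost_iff carrier_vecD)
    finally show "(M *\<^sub>v u j) $ i = (\<Oplus>\<^bsub>V\<^esub>k\<in>{0..d}. X $$ (k, j) \<cdot>\<^sub>v u k) $ i"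
      using eq[of i j] i j by (simp add: atMost_atLeast0)
  qed
  then show ?thesis using assms by (simp add: represents_def module_vec_simps)
qed

lemma ordered_basis_unit_vec: "ordered_basis (module_vec TYPE('a::field) (d + 1)) d (unit_vec (Suc d))"
proof (rule ordered_basis_vecI)
  fix b :: "nat \<Rightarrow> 'a"
  assume *: "\<And>i. i \<le> d \<Longrightarrow> (\<Sum>k\<le>d. b k * unit_vec (Suc d) k $ i) = 0"
  show "\<forall>k\<le>d. b k = 0"
  proof (intro allI impI)
    fix i assume i: "i \<le> d"
    have "(\<Sum>k\<le>d. b k * unit_vec (Suc d) k $ i) = (\<Sum>k\<le>d. if k = i then b i else 0)"
      using i by (intro sum.cong) auto
    then show "b i = 0" using *[OF i] i by simp
  qed
qed auto

lemma represents_unit_vec: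
  assumes "M \<in> carrier_mat (Suc d) (Suc d)"
  shows "represents (module_vec TYPE('a::field) (d + 1)) d (unit_vec (Suc d)) M (\<lambda>v. M *\<^sub>v v)"
proof (rule represents_vecI[OF assms assms])
  fix i j assume ij: "i \<le> d" "j \<le> d"
  have "(\<Sum>k\<le>d. M $$ (k, j) * unit_vec (Suc d) k $ i) = (\<Sum>k\<le>d. if k = i then M $$ (i, j) else 0)"
    using ij by (intro sum.cong) auto
  then show "(M *\<^sub>v unit_vec (Suc d) j) $ i = (\<Sum>k\<le>d. M $$ (k, j) * unit_vec (Suc d) k $ i)"
    using ij assms by simp
qed auto

section \<open>The ladder of eigenvectors\<close>

text \<open>Entry \<open>i\<close> of the image of \<open>w\<close> under the first matrix is \<open>a\<^sub>i w\<^sub>i + (\<lambda>\<^sub>0 - a\<^sub>i) w\<^sub>i\<^sub>-\<^sub>1\<close>, so the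
  all-ones vector has eigenvalue \<open>\<lambda>\<^sub>0\<close>. The assumption \<open>step\<close> says that \<open>A\<^sup>* - c\<^sub>k\<close> sends
  eigenvectors of \<open>A\<close> for \<open>\<lambda>\<^sub>k\<close> to eigenvectors for \<open>\<lambda>\<^sub>k\<^sub>+\<^sub>1\<close>.\<close>

locale eigen_ladder =
  fixes d :: nat and a \<theta> eig c :: "nat \<Rightarrow> 'a::field"
  assumes d: "1 \<le> d"
    and step: "\<And>i k. i \<le> d \<Longrightarrow> k \<le> d \<Longrightarrow>
      a i * (\<theta> i - \<theta> ((i + d) mod Suc d)) + (\<theta> ((i + d) mod Suc d) - c k) * eig k
        = eig (Suc k) * (\<theta> i - c k)"
    and closed: "eig (Suc d) = eig 0"
    and inj: "inj_on eig {..d}"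
    and c_neq: "\<And>i k. i \<le> d \<Longrightarrow> k \<le> d \<Longrightarrow> \<theta> i \<noteq> c k"
    and a_neq: "\<And>i. i \<le> d \<Longrightarrow> a i \<noteq> eig 0"
begin

definition "A = circ_mat d a (eig 0)"
definition "As = diag_seq_mat d \<theta>"
text \<open>This is the product of the maps \<open>As - c j\<close>, \<open>j < k\<close>, applied
  to the all-ones vector; in particular \<open>u 0\<close> is the all-ones vector.\<close>

definition "u k = vec (Suc d) (\<lambda>i. \<Prod>j<k. \<theta> i - c j)"

lemma u_carrier [simp]: "u k \<in> carrier_vec (Suc d)"
  by (simp add: u_def)

lemma u_index: "i \<le> d \<Longrightarrow> u k $ i = (\<Prod>j<k. \<theta> i - c j)"
  by (simp add: u_def)

lemma u_nonzero: "i \<le> d \<Longrightarrow> k \<le> Suc d \<Longrightarrow> u k $ i \<noteq> 0"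
  using c_neq by (auto simp: u_index)

text \<open>Row \<open>i\<close> of the eigenvector equation, by climbing the ladder from the
  all-ones vector. The range includes \<open>k = Suc d\<close>, one beyond the basis, because that
  vector decides how the ladder closes up.\<close>

lemma u_row:
  assumes i: "i \<le> d" and k: "k \<le> Suc d"
  shows "a i * u k $ i + (eig 0 - a i) * u k $ ((i + d) mod Suc d) = eig k * u k $ i"
  using k
proof (induction k)
  case 0
  show ?case using i by (simp add: u_index algebra_simps)
next
  case (Suc k)
  let ?p = "(i + d) mod Suc d"
  have p: "?p \<le> d" by (rule pred_le)
  have Si: "u (Suc k) $ i = u k $ i * (\<theta> i - c k)" "u (Suc k) $ ?p = u k $ ?p * (\<theta> ?p - c k)"
    using i p by (simp_all add: u_index)
  \<comment> \<open>Solved for the neighbouring entry, so that substituting it leaves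
    \<open>u k $ i\<close> times the left side of \<open>step\<close>.\<close>
  have IH: "(eig 0 - a i) * u k $ ?p = eig k * u k $ i - a i * u k $ i"
    using Suc by (simp add: algebra_simps)
  have "a i * u (Suc k) $ i + (eig 0 - a i) * u (Suc k) $ ?p
      = a i * u k $ i * (\<theta> i - c k) + ((eig 0 - a i) * u k $ ?p) * (\<theta> ?p - c k)"
    by (simp add: Si)
  also have "\<dots> = (a i * (\<theta> i - \<theta> ?p) + (\<theta> ?p - c k) * eig k) * u k $ i"
    unfolding IH by (simp add: algebra_simps)
  also have "\<dots> = eig (Suc k) * u (Suc k) $ i"
    using step[OF i, of k] Suc.prems by (simp add: Si)
  finally show ?case .
qed

lemma A_u: "i \<le> d \<Longrightarrow> k \<le> Suc d \<Longrightarrow> (A *\<^sub>v u k) $ i = eig k * u k $ i"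
  by (simp add: A_def circ_mat_mult_index[OF d] u_row del: index_mult_mat_vec)

text \<open>The argument for distinct eigenvalues: \<open>A - eig m\<close> kills the last term of a
  vanishing combination and multiplies the others by the nonzero factors
  \<open>eig k - eig m\<close>. By induction only the multiple of \<open>u m\<close> survives, and
  \<open>u m\<close> has a nonzero entry.\<close>

lemma u_indep:
  assumes "m \<le> Suc d" "\<And>i. i \<le> d \<Longrightarrow> (\<Sum>k<m. b k * u k $ i) = 0"
  shows "\<forall>k<m. b k = 0"
  using assms
proof (induction m arbitrary: b)
  case (Suc m)
  have red: "(\<Sum>k<m. (b k * (eig k - eig m)) * u k $ i) = 0" if i: "i \<le> d" for i
  proof -
    let ?p = "(i + d) mod Suc d"
    have p: "?p \<le> d" by (rule pred_le)
    have "(\<Sum>k<Suc m. b k * (eig k * u k $ i)) =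
       (\<Sum>k<Suc m. a i * (b k * u k $ i) + (eig 0 - a i) * (b k * u k $ ?p))"
      using Suc.prems(1) i by (intro sum.cong refl) (simp add: u_row[symmetric] algebra_simps)
    also have "\<dots> = 0"
      unfolding sum.distrib sum_distrib_left[symmetric] Suc.prems(2)[OF i] Suc.prems(2)[OF p] by simp
    finally have 1: "(\<Sum>k<Suc m. b k * (eig k * u k $ i)) = 0" .
    have "(\<Sum>k<m. (b k * (eig k - eig m)) * u k $ i) = (\<Sum>k<Suc m. (b k * (eig k - eig m)) * u k $ i)"
      by simp
    also have "\<dots> = (\<Sum>k<Suc m. b k * (eig k * u k $ i)) - eig m * (\<Sum>k<Suc m. b k * u k $ i)"
      unfolding sum_distrib_left sum_subtractf[symmetric]
      by (intro sum.cong refl) (simp add: algebra_simps)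
    finally show ?thesis unfolding 1 Suc.prems(2)[OF i] by simp
  qed
  have "\<forall>k<m. b k * (eig k - eig m) = 0"
    by (rule Suc.IH[OF _ red]) (use Suc.prems(1) in auto)
  moreover have "eig k \<noteq> eig m" if "k < m" for k
    using inj_onD[OF inj, of k m] that Suc.prems(1) by auto
  ultimately have b0: "b k = 0" if "k < m" for k using that by auto
  then have "b m * u m $ 0 = 0" using Suc.prems(2)[of 0] by simp
  then have "b m = 0" using u_nonzero[of 0 m] Suc.prems(1) by simp
  then show ?case using b0 by (auto simp: less_Suc_eq)
qed simp

lemma u_basis: "ordered_basis (module_vec TYPE('a) (d + 1)) d u"
proof (rule ordered_basis_vecI)
  fix b assume "\<And>i. i \<le> d \<Longrightarrow> (\<Sum>k\<le>d. b k * u k $ i) = 0"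
  then show "\<forall>k\<le>d. b k = 0"
    using u_indep[of "Suc d" b] unfolding lessThan_Suc_atMost less_Suc_eq_le by blast
qed simp

text \<open>As \<open>\<lambda>\<^sub>d\<^sub>+\<^sub>1 = \<lambda>\<^sub>0\<close>, the row equation for \<open>u\<^sub>d\<^sub>+\<^sub>1\<close> says that neighbouring entries agree.\<close>

lemma u_last: "i \<le> d \<Longrightarrow> u (Suc d) $ i = u (Suc d) $ 0"
proof (induction i)
  case (Suc i)
  have "(Suc i + d) mod Suc d = i" using Suc.prems by (subst pred_mod) auto
  then have "(eig 0 - a (Suc i)) * u (Suc d) $ i = (eig 0 - a (Suc i)) * u (Suc d) $ Suc i"
    using u_row[OF Suc.prems, of "Suc d"] closed by (simp add: algebra_simps)
  then show ?case using a_neq[OF Suc.prems] Suc by simp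
qed simp

text \<open>The standard basis serves condition (i) and the ladder \<open>u\<close> serves condition
  (ii). In the latter, \<open>As\<close> sends \<open>u j\<close> to \<open>c j\<close> times itself
  plus \<open>u (Suc j)\<close>, which explains the ones below the diagonal of
  \<open>X\<close>.\<close>

lemma circular_bidiagonal_pair: "circular_bidiagonal_pair (module_vec TYPE('a) (d + 1)) d (\<lambda>v. A *\<^sub>v v) (\<lambda>v. As *\<^sub>v v)"
proof -
  have AC: "A \<in> carrier_mat (Suc d) (Suc d)" and AsC: "As \<in> carrier_mat (Suc d) (Suc d)"
    by (simp_all add: A_def As_def)
  have "circular_bidiagonal_mat d A"
    unfolding circular_bidiagonal_mat_def
  proof (intro conjI ballI allI impI)
    fix i j assume ij: "i \<le> d" "j \<le> d" and nz: "A $$ (i, j) \<noteq> 0"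
    then have "i = j \<or> j = (i + d) mod Suc d" by (auto simp: A_def circ_mat_def split: if_splits)
    then show "i = j \<or> i = j + 1 \<or> i = 0 \<and> j = d" using pred_mod[of i d] ij by (auto split: if_splits)
  next
    fix i assume "i \<in> {1..d}"
    then have "i \<le> d" "i \<noteq> i - 1" "i - 1 = (i + d) mod Suc d" using pred_mod[of i d] by auto
    then show "A $$ (i, i - 1) \<noteq> 0" using a_neq[of i]
      by (simp add: A_def circ_mat_def)
  next
    show "A $$ (0, d) \<noteq> 0" using a_neq[of 0] d by (auto simp: A_def circ_mat_def)
  qed (use d AC in auto)
  moreover have "diagonal_mat As" by (auto simp: diagonal_mat_def As_def diag_seq_mat_def)
  moreover define X where "X = mat (d + 1) (d + 1) (\<lambda>(i, j). if i = j then c j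
      else if i = Suc j then 1 else if i = 0 \<and> j = d then u (Suc d) $ 0 else 0)"
  have XC: "X \<in> carrier_mat (Suc d) (Suc d)" by (simp add: X_def)
  have "circular_bidiagonal_mat d X"
    unfolding circular_bidiagonal_mat_def
  proof (intro conjI ballI allI impI)
    fix i j assume "i \<le> d" "j \<le> d" "X $$ (i, j) \<noteq> 0"
    then show "i = j \<or> i = j + 1 \<or> i = 0 \<and> j = d" by (auto simp: X_def split: if_splits)
  next
    fix i assume "i \<in> {1..d}"
    then have "i \<le> d" "i \<noteq> i - 1" "i = Suc (i - 1)" by auto
    then show "X $$ (i, i - 1) \<noteq> 0" by (simp add: X_def)
  next
    show "X $$ (0, d) \<noteq> 0" using d u_nonzero[of 0 "Suc d"] by (auto simp: X_def)
  qed (use d XC in auto)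
  moreover have "diagonal_mat (diag_seq_mat d eig)" by (auto simp: diagonal_mat_def diag_seq_mat_def)
  moreover have "represents (module_vec TYPE('a) (d + 1)) d u X (\<lambda>v. As *\<^sub>v v)"
  proof (rule represents_vecI[OF XC AsC u_carrier])
    fix i j assume ij: "i \<le> d" "j \<le> d"
    \<comment> \<open>The successor of \<open>j\<close> on the cycle. For \<open>j = d\<close>, the
      vector \<open>u (Suc d)\<close> is constant, hence \<open>u (Suc d) $ 0\<close> times the
      all-ones vector \<open>u 0\<close>; this is the corner entry of \<open>X\<close>.\<close>
    let ?s = "if j = d then 0 else Suc j"
    have "(\<Sum>k\<le>d. X $$ (k, j) * u k $ i) = (\<Sum>k\<le>d. (if k = j then c j * u j $ i else 0)
        + (if k = ?s then (if j = d then u (Suc d) $ 0 else 1) * u ?s $ i else 0))"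
      using d ij by (intro sum.cong) (auto simp: X_def)
    also have "\<dots> = c j * u j $ i + (if j = d then u (Suc d) $ 0 else 1) * u ?s $ i"
      using ij by (subst sum.distrib) auto
    also have "\<dots> = c j * u j $ i + u (Suc j) $ i"
      using u_last[OF ij(1)] ij by (auto simp: u_index[of i 0])
    also have "\<dots> = \<theta> i * u j $ i" using ij by (simp add: u_index algebra_simps)
    finally show "(As *\<^sub>v u j) $ i = (\<Sum>k\<le>d. X $$ (k, j) * u k $ i)"
      using ij by (simp add: As_def diag_seq_mat_mult_index del: index_mult_mat_vec)
  qed
  moreover have "represents (module_vec TYPE('a) (d + 1)) d u (diag_seq_mat d eig) (\<lambda>v. A *\<^sub>v v)"
  proof (rule represents_vecI[OF _ AC u_carrier])
    fix i j assume ij: "i \<le> d" "j \<le> d"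
    have "(\<Sum>k\<le>d. diag_seq_mat d eig $$ (k, j) * u k $ i) = (\<Sum>k\<le>d. if k = j then eig j * u j $ i else 0)"
      using ij by (intro sum.cong) (auto simp: diag_seq_mat_def)
    then show "(A *\<^sub>v u j) $ i = (\<Sum>k\<le>d. diag_seq_mat d eig $$ (k, j) * u k $ i)"
      using A_u[of i j] ij by (simp del: index_mult_mat_vec)
  qed simp
  moreover have "linear_map class_ring (module_vec TYPE('a) (d + 1)) (module_vec TYPE('a) (d + 1)) (\<lambda>v. A *\<^sub>v v)"
    "linear_map class_ring (module_vec TYPE('a) (d + 1)) (module_vec TYPE('a) (d + 1)) (\<lambda>v. As *\<^sub>v v)"
    using AC AsC by (simp_all add: linear_map_mult_mat_vec)
  ultimately show ?thesis
    unfolding circular_bidiagonal_pair_def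
    using ordered_basis_unit_vec u_basis represents_unit_vec[OF AC] represents_unit_vec[OF AsC]
    by blast
qed

text \<open>Expand an eigenvector in the basis \<open>u\<close>: its coefficients are annihilated by
  the factors \<open>eig k - \<mu>\<close>, so they all vanish unless one of these factors is
  zero.\<close>

lemma eigenvalue_A:
  assumes w: "w \<in> carrier_vec (Suc d)" "w \<noteq> 0\<^sub>v (Suc d)" and ev: "A *\<^sub>v w = \<mu> \<cdot>\<^sub>v w"
  shows "\<exists>k\<le>d. \<mu> = eig k"
proof (rule ccontr)
  assume no: "\<not> ?thesis"
  obtain b where b: "\<And>i. i \<le> d \<Longrightarrow> w $ i = (\<Sum>k\<le>d. b k * u k $ i)"
    using ordered_basis_vec_expand[OF u_basis w(1)] by blast
  have "(\<Sum>k\<le>d. (b k * (eig k - \<mu>)) * u k $ i) = 0" if i: "i \<le> d" for i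
  proof -
    let ?p = "(i + d) mod Suc d"
    have p: "?p \<le> d" by (rule pred_le)
    have "\<mu> * w $ i = a i * w $ i + (eig 0 - a i) * w $ ?p"
      using arg_cong[OF ev, of "\<lambda>v. v $ i"] w(1) i by (simp add: A_def circ_mat_mult_index[OF d] del: index_mult_mat_vec)
    also have "\<dots> = (\<Sum>k\<le>d. b k * eig k * u k $ i)"
      unfolding b[OF i] b[OF p] sum_distrib_left sum.distrib[symmetric]
    proof (intro sum.cong refl)
      fix k assume "k \<in> {..d}"
      then show "a i * (b k * u k $ i) + (eig 0 - a i) * (b k * u k $ ?p) = b k * eig k * u k $ i"
        using arg_cong[OF u_row[OF i, of k], of "(*) (b k)"] by (simp add: algebra_simps)
    qed
    finally show ?thesis
      unfolding b[OF i] sum_distrib_left by (simp add: algebra_simps sum_subtractf)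
  qed
  then have "\<forall>k\<le>d. b k * (eig k - \<mu>) = 0"
    using u_indep[of "Suc d" "\<lambda>k. b k * (eig k - \<mu>)"]
    unfolding lessThan_Suc_atMost less_Suc_eq_le by blast
  then have "b k = 0" if "k \<le> d" for k using no that by auto
  then have "w $ i = 0" if "i \<le> d" for i using b[OF that] by simp
  then have "w = 0\<^sub>v (Suc d)" using w by (intro eq_vecI) auto
  then show False using w by simp
qed

lemma eigenvalue_As:
  assumes w: "w \<in> carrier_vec (Suc d)" "w \<noteq> 0\<^sub>v (Suc d)" and ev: "As *\<^sub>v w = \<mu> \<cdot>\<^sub>v w"
  shows "\<exists>k\<le>d. \<mu> = \<theta> k"
proof -
  obtain i where i: "i \<le> d" "w $ i \<noteq> 0"
    using w eq_vecI[of w "0\<^sub>v (Suc d)"] by (auto simp: less_Suc_eq_le)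
  then have "\<theta> i * w $ i = \<mu> * w $ i"
    using arg_cong[OF ev, of "\<lambda>v. v $ i"] w(1) by (simp add: As_def diag_seq_mat_mult_index del: index_mult_mat_vec)
  then show ?thesis using i by auto
qed

end

section \<open>What an isomorphism of pairs transports\<close>

lemma isomorphic_pairs_vec_iff:
  "isomorphic_pairs (module_vec TYPE('a::field) n) F G (module_vec TYPE('a) n) F' G' \<longleftrightarrow>
    (\<exists>\<sigma>. (\<forall>v\<in>carrier_vec n. \<sigma> v \<in> carrier_vec n) \<and>
      (\<forall>v w. v \<in> carrier_vec n \<and> w \<in> carrier_vec n \<longrightarrow> \<sigma> (v + w) = \<sigma> v + \<sigma> w) \<and>
      (\<forall>r v. v \<in> carrier_vec n \<longrightarrow> \<sigma> (r \<cdot>\<^sub>v v) = r \<cdot>\<^sub>v \<sigma> v) \<and>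
      bij_betw \<sigma> (carrier_vec n) (carrier_vec n) \<and>
      (\<forall>v\<in>carrier_vec n. \<sigma> (F v) = F' (\<sigma> v)) \<and> (\<forall>v\<in>carrier_vec n. \<sigma> (G v) = G' (\<sigma> v)))"
  unfolding isomorphic_pairs_def linear_map_def mod_hom_def mod_hom_axioms_def
    LinearCombinations.module_hom_def
  using vec_vs[where 'a = 'a and n = n] vec_module[where 'a = 'a and n = n]
  by (simp add: module_vec_simps class_ring_simps Pi_iff)

lemma affine_map_vec:
  "affine_map (module_vec TYPE('a::field) n) s t F = (\<lambda>v. s \<cdot>\<^sub>v F v + t \<cdot>\<^sub>v v)"
  by (simp add: affine_map_def module_vec_simps)

lemma zero_smult_vec: "(0::'a::field) \<cdot>\<^sub>v w = 0\<^sub>v (dim_vec w)"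
  by auto

text \<open>The image of \<open>w\<close> under the isomorphism is the required eigenvector, nonzero
  by injectivity. Only the first map of each pair is treated; \<open>isomorphic_pairs_swap\<close>
  gives the second.\<close>

lemma affine_isomorphic_eigenvector:
  fixes w :: "'a::field vec"
  assumes "isomorphic_pairs (module_vec TYPE('a) n) (affine_map (module_vec TYPE('a) n) s t F) G
      (module_vec TYPE('a) n) F' G'"
    and w: "w \<in> carrier_vec n" "w \<noteq> 0\<^sub>v n" "F w = \<mu> \<cdot>\<^sub>v w"
  obtains w' where "w' \<in> carrier_vec n" "w' \<noteq> 0\<^sub>v n" "F' w' = (s * \<mu> + t) \<cdot>\<^sub>v w'"
proof -
  obtain \<sigma> where \<sigma>: "\<And>v. v \<in> carrier_vec n \<Longrightarrow> \<sigma> v \<in> carrier_vec n"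
    "\<And>r v. v \<in> carrier_vec n \<Longrightarrow> \<sigma> (r \<cdot>\<^sub>v v) = r \<cdot>\<^sub>v \<sigma> v" "bij_betw \<sigma> (carrier_vec n) (carrier_vec n)"
    "\<And>v. v \<in> carrier_vec n \<Longrightarrow> \<sigma> (s \<cdot>\<^sub>v F v + t \<cdot>\<^sub>v v) = F' (\<sigma> v)"
    using assms(1) unfolding isomorphic_pairs_vec_iff affine_map_vec by blast
  have "\<sigma> (0\<^sub>v n) = 0\<^sub>v n"
    using \<sigma>(2)[of "0\<^sub>v n" 0] \<sigma>(1)[of "0\<^sub>v n"] by (metis carrier_vecD zero_carrier_vec zero_smult_vec)
  then have "\<sigma> w \<noteq> 0\<^sub>v n"
    using inj_onD[OF bij_betw_imp_inj_on[OF \<sigma>(3)], of w "0\<^sub>v n"] w by auto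
  moreover have "s \<cdot>\<^sub>v F w + t \<cdot>\<^sub>v w = (s * \<mu> + t) \<cdot>\<^sub>v w"
    unfolding w(3) using w(1) by (simp add: add_smult_distrib_vec smult_smult_assoc)
  then have "F' (\<sigma> w) = (s * \<mu> + t) \<cdot>\<^sub>v \<sigma> w"
    using \<sigma>(2,4) w(1) by metis
  ultimately show thesis using that \<sigma>(1) w(1) by blast
qed

text \<open>The isomorphism sends the left side at \<open>w\<close> to the same expression in
  \<open>F'\<close> and \<open>G'\<close> at the image of \<open>w\<close>, which is zero;
  injectivity finishes. Pulling back keeps the coefficients those of the target pair, so the unknown
  affine scalars enter only through \<open>F\<close> and \<open>G\<close>.\<close>

lemma isomorphic_pairs_pull_back_relation:
  fixes F G F' G' :: "'a::field vec \<Rightarrow> 'a vec"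
  assumes "isomorphic_pairs (module_vec TYPE('a) n) F G (module_vec TYPE('a) n) F' G'"
    and F: "\<And>v. v \<in> carrier_vec n \<Longrightarrow> F v \<in> carrier_vec n"
    and G: "\<And>v. v \<in> carrier_vec n \<Longrightarrow> G v \<in> carrier_vec n"
    and rel: "\<And>v. v \<in> carrier_vec n \<Longrightarrow> x1 \<cdot>\<^sub>v F' (G' v) + (x2 \<cdot>\<^sub>v G' (F' v) +
      (x3 \<cdot>\<^sub>v F' v + (x4 \<cdot>\<^sub>v G' v + x5 \<cdot>\<^sub>v v))) = 0\<^sub>v n"
    and w: "w \<in> carrier_vec n"
  shows "x1 \<cdot>\<^sub>v F (G w) + (x2 \<cdot>\<^sub>v G (F w) + (x3 \<cdot>\<^sub>v F w + (x4 \<cdot>\<^sub>v G w + x5 \<cdot>\<^sub>v w))) = 0\<^sub>v n"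
    (is "?R = _")
proof -
  obtain \<sigma> where \<sigma>: "\<And>v. v \<in> carrier_vec n \<Longrightarrow> \<sigma> v \<in> carrier_vec n"
    "\<And>v w. v \<in> carrier_vec n \<Longrightarrow> w \<in> carrier_vec n \<Longrightarrow> \<sigma> (v + w) = \<sigma> v + \<sigma> w"
    "\<And>r v. v \<in> carrier_vec n \<Longrightarrow> \<sigma> (r \<cdot>\<^sub>v v) = r \<cdot>\<^sub>v \<sigma> v" "bij_betw \<sigma> (carrier_vec n) (carrier_vec n)"
    "\<And>v. v \<in> carrier_vec n \<Longrightarrow> \<sigma> (F v) = F' (\<sigma> v)"
    "\<And>v. v \<in> carrier_vec n \<Longrightarrow> \<sigma> (G v) = G' (\<sigma> v)"
    using assms(1) unfolding isomorphic_pairs_vec_iff by blast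
  have "\<sigma> (0\<^sub>v n) = 0\<^sub>v n"
    using \<sigma>(3)[of "0\<^sub>v n" 0] \<sigma>(1)[of "0\<^sub>v n"] by (metis carrier_vecD zero_carrier_vec zero_smult_vec)
  moreover have "\<sigma> ?R = 0\<^sub>v n"
    using rel[of "\<sigma> w"] by (simp add: \<sigma>(1-3,5,6) F G w)
  ultimately show ?thesis
    using inj_onD[OF bij_betw_imp_inj_on[OF \<sigma>(4)], of ?R "0\<^sub>v n"] F G w by simp
qed

text \<open>A relation \<open>x\<^sub>1 B B\<^sup>* + x\<^sub>2 B\<^sup>* B + x\<^sub>3 B + x\<^sub>4 B\<^sup>* + x\<^sub>5 = 0\<close> is pulled back along the isomorphism;
  the conclusions are the subdiagonal and the diagonal entries of the resulting relation.\<close>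

lemma affine_circ_relation:
  fixes a \<theta> a' \<theta>' :: "nat \<Rightarrow> 'a::field"
  assumes d: "1 \<le> d" and "s \<noteq> 0" and a: "\<And>i. i \<le> d \<Longrightarrow> a i \<noteq> e"
    and iso: "isomorphic_pairs (module_vec TYPE('a) (d + 1))
      (affine_map (module_vec TYPE('a) (d + 1)) s t (\<lambda>v. circ_mat d a e *\<^sub>v v))
      (affine_map (module_vec TYPE('a) (d + 1)) ss ts (\<lambda>v. diag_seq_mat d \<theta> *\<^sub>v v))
      (module_vec TYPE('a) (d + 1)) (\<lambda>v. circ_mat d a' e' *\<^sub>v v) (\<lambda>v. diag_seq_mat d \<theta>' *\<^sub>v v)"
    and off: "\<And>i. i \<le> d \<Longrightarrow> x1 * \<theta>' ((i + d) mod Suc d) + x2 * \<theta>' i + x3 = 0"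
    and diag: "\<And>i. i \<le> d \<Longrightarrow> (x1 + x2) * a' i * \<theta>' i + x3 * a' i + x4 * \<theta>' i + x5 = 0"
    and i: "i \<le> d"
  shows "x1 * (ss * \<theta> ((i + d) mod Suc d) + ts) + x2 * (ss * \<theta> i + ts) + x3 = 0" (is ?off)
    and "(x1 + x2) * (s * a i + t) * (ss * \<theta> i + ts) + x3 * (s * a i + t) + x4 * (ss * \<theta> i + ts) + x5 = 0"
      (is ?diag)
proof -
  let ?p = "(i + d) mod Suc d"
  have ne: "?p \<noteq> i" using pred_mod_neq[OF d i] .
  define F where "F = (\<lambda>v. s \<cdot>\<^sub>v (circ_mat d a e *\<^sub>v v) + t \<cdot>\<^sub>v v)"
  define G where "G = (\<lambda>v. ss \<cdot>\<^sub>v (diag_seq_mat d \<theta> *\<^sub>v v) + ts \<cdot>\<^sub>v v)"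
  define F' where "F' = (\<lambda>v. circ_mat d a' e' *\<^sub>v v)"
  define G' where "G' = (\<lambda>v. diag_seq_mat d \<theta>' *\<^sub>v v)"
  have carr: "F v \<in> carrier_vec (Suc d)" "G v \<in> carrier_vec (Suc d)"
    "F' v \<in> carrier_vec (Suc d)" "G' v \<in> carrier_vec (Suc d)" if "v \<in> carrier_vec (Suc d)" for v
    using that mult_mat_vec_carrier[OF circ_mat_carrier] mult_mat_vec_carrier[OF diag_seq_mat_carrier]
    by (auto simp: F_def G_def F'_def G'_def intro!: add_carrier_vec)
  have dims: "dim_vec (F v) = Suc d" "dim_vec (G v) = Suc d"
    "dim_vec (F' v) = Suc d" "dim_vec (G' v) = Suc d" if "v \<in> carrier_vec (Suc d)" for v
    using carr[OF that] by auto
  have idx: "F v $ j = (s * a j + t) * v $ j + s * (e - a j) * v $ ((j + d) mod Suc d)"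
    "G v $ j = (ss * \<theta> j + ts) * v $ j"
    "F' v $ j = a' j * v $ j + (e' - a' j) * v $ ((j + d) mod Suc d)"
    "G' v $ j = \<theta>' j * v $ j" if "v \<in> carrier_vec (Suc d)" "j \<le> d" for v j
    using that by (simp_all add: F_def G_def F'_def G'_def circ_mat_mult_index[OF d]
        diag_seq_mat_mult_index algebra_simps del: index_mult_mat_vec)
  have rel': "x1 \<cdot>\<^sub>v F' (G' v) + (x2 \<cdot>\<^sub>v G' (F' v) + (x3 \<cdot>\<^sub>v F' v + (x4 \<cdot>\<^sub>v G' v + x5 \<cdot>\<^sub>v v))) = 0\<^sub>v (Suc d)"
    (is "?R = _") if v: "v \<in> carrier_vec (Suc d)" for v
  proof (rule eq_vecI)
    fix j assume "j < dim_vec (0\<^sub>v (Suc d) :: 'a vec)"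
    then have j: "j \<le> d" by simp
    let ?r = "(j + d) mod Suc d"
    \<comment> \<open>Row \<open>j\<close> involves only \<open>v $ j\<close> and its cyclic
      neighbour. Their coefficients are the left side of \<open>diag\<close> and a multiple of the
      left side of \<open>off\<close>.\<close>
    have "?R $ j = ((x1 + x2) * a' j * \<theta>' j + x3 * a' j + x4 * \<theta>' j + x5) * v $ j
        + (e' - a' j) * (x1 * \<theta>' ?r + x2 * \<theta>' j + x3) * v $ ?r"
      using v j by (simp add: dims carr idx algebra_simps)
    then show "?R $ j = 0\<^sub>v (Suc d) $ j" using off[OF j] diag[OF j] j by simp
  qed (use v carr in simp)
  have R: "((x1 + x2) * (s * a i + t) * (ss * \<theta> i + ts) + x3 * (s * a i + t) + x4 * (ss * \<theta> i + ts) + x5) * w $ i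
        + s * (e - a i) * (x1 * (ss * \<theta> ?p + ts) + x2 * (ss * \<theta> i + ts) + x3) * w $ ?p = 0"
    if w: "w \<in> carrier_vec (Suc d)" for w
  proof -
    have iso': "isomorphic_pairs (module_vec TYPE('a) (Suc d)) F G (module_vec TYPE('a) (Suc d)) F' G'"
      using iso unfolding affine_map_vec F_def G_def F'_def G'_def by simp
    have "x1 \<cdot>\<^sub>v F (G w) + (x2 \<cdot>\<^sub>v G (F w) + (x3 \<cdot>\<^sub>v F w + (x4 \<cdot>\<^sub>v G w + x5 \<cdot>\<^sub>v w))) = 0\<^sub>v (Suc d)"
      by (rule isomorphic_pairs_pull_back_relation[OF iso' carr(1,2) rel' w])
    from arg_cong[OF this, of "\<lambda>v. v $ i"] show ?thesis
      using w i by (simp add: dims carr idx algebra_simps)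
  qed
  \<comment> \<open>Two unit vectors separate the two coefficients. The off-diagonal one carries the
    factor \<open>s * (e - a i)\<close>, which is nonzero and can be cancelled.\<close>
  show ?diag using R[of "unit_vec (Suc d) i"] i ne by simp
  show ?off using R[of "unit_vec (Suc d) ?p"] i ne assms(2) a[OF i] by simp
qed

text \<open>Rotating coordinates by \<open>m\<close> commutes with passing to the predecessor, so it
  merely rotates the sequence \<open>a\<close> and keeps the row sum \<open>e\<close>. The first map
  therefore needs no rescaling, and only the second uses its affine freedom.\<close>

lemma shift_isomorphic_pairs:
  fixes a \<theta> a' \<theta>' :: "nat \<Rightarrow> 'a::field"
  assumes d: "1 \<le> d" and m: "m \<le> d"
    and a': "\<And>i. i \<le> d \<Longrightarrow> a' i = a ((i + m) mod Suc d)"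
    and \<theta>': "\<And>i. i \<le> d \<Longrightarrow> \<theta>' i = ss * \<theta> ((i + m) mod Suc d) + ts"
  shows "isomorphic_pairs (module_vec TYPE('a) (d + 1))
      (affine_map (module_vec TYPE('a) (d + 1)) 1 0 (\<lambda>v. circ_mat d a e *\<^sub>v v))
      (affine_map (module_vec TYPE('a) (d + 1)) ss ts (\<lambda>v. diag_seq_mat d \<theta> *\<^sub>v v))
      (module_vec TYPE('a) (d + 1)) (\<lambda>v. circ_mat d a' e *\<^sub>v v) (\<lambda>v. diag_seq_mat d \<theta>' *\<^sub>v v)"
proof -
  define \<sigma> :: "nat \<Rightarrow> 'a vec \<Rightarrow> 'a vec" where
    "\<sigma> k v = vec (Suc d) (\<lambda>i. v $ ((i + k) mod Suc d))" for k v
  have \<sigma>_carrier: "\<sigma> k v \<in> carrier_vec (Suc d)" for k v by (simp add: \<sigma>_def)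
  have mod_le: "x mod Suc d \<le> d" for x using mod_less_divisor[of "Suc d" x] by simp
  \<comment> \<open>The inverse rotation is by \<open>Suc d - m\<close>; for \<open>m = 0\<close>
    this is a full turn, hence \<open>k\<close> and \<open>l\<close> are not bounded by
    \<open>d\<close>.\<close>
  have inv: "\<sigma> k (\<sigma> l v) = v" if "v \<in> carrier_vec (Suc d)" "k + l = Suc d" for k l v
  proof (rule eq_vecI)
    fix i assume i: "i < dim_vec v"
    have "(i + k + l) mod Suc d = i" using i that(1) unfolding add.assoc that(2) mod_add_self2 by simp
    then show "\<sigma> k (\<sigma> l v) $ i = v $ i" using i that mod_le[of "i + k"]
      by (simp add: \<sigma>_def mod_add_left_eq)
  qed (use that in \<open>simp add: \<sigma>_def\<close>)
  have "bij_betw (\<sigma> m) (carrier_vec (Suc d)) (carrier_vec (Suc d))"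
    by (rule bij_betwI[where g = "\<sigma> (Suc d - m)"])
      (use m in \<open>auto intro!: inv simp: \<sigma>_carrier\<close>)
  moreover have "\<sigma> m (1 \<cdot>\<^sub>v (circ_mat d a e *\<^sub>v v) + 0 \<cdot>\<^sub>v v) = circ_mat d a' e *\<^sub>v \<sigma> m v"
    if v: "v \<in> carrier_vec (Suc d)" for v
  proof (rule eq_vecI)
    fix i assume "i < dim_vec (circ_mat d a' e *\<^sub>v \<sigma> m v)"
    then have i: "i \<le> d" by simp
    have "((i + m) mod Suc d + d) mod Suc d = ((i + d) mod Suc d + m) mod Suc d"
      by (simp only: mod_add_left_eq) (simp only: add.assoc add.commute[of m])
    moreover have "\<sigma> m v \<in> carrier_vec (Suc d)" by (simp add: \<sigma>_def)
    ultimately show "\<sigma> m (1 \<cdot>\<^sub>v (circ_mat d a e *\<^sub>v v) + 0 \<cdot>\<^sub>v v) $ i = (circ_mat d a' e *\<^sub>v \<sigma> m v) $ i"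
      using i v mod_le[of "i + m"] mod_le[of "i + d"]
      by (simp add: circ_mat_mult_index[OF d] \<sigma>_def a' del: index_mult_mat_vec)
  qed (simp add: \<sigma>_def)
  moreover have "\<sigma> m (ss \<cdot>\<^sub>v (diag_seq_mat d \<theta> *\<^sub>v v) + ts \<cdot>\<^sub>v v) = diag_seq_mat d \<theta>' *\<^sub>v \<sigma> m v"
    if v: "v \<in> carrier_vec (Suc d)" for v
  proof (rule eq_vecI)
    fix i assume "i < dim_vec (diag_seq_mat d \<theta>' *\<^sub>v \<sigma> m v)"
    then have i: "i \<le> d" by simp
    have "\<sigma> m v \<in> carrier_vec (Suc d)" by (simp add: \<sigma>_def)
    then show "\<sigma> m (ss \<cdot>\<^sub>v (diag_seq_mat d \<theta> *\<^sub>v v) + ts \<cdot>\<^sub>v v) $ i = (diag_seq_mat d \<theta>' *\<^sub>v \<sigma> m v) $ i"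
      using i v mod_le[of "i + m"]
      by (simp add: diag_seq_mat_mult_index \<sigma>_def \<theta>' algebra_simps del: index_mult_mat_vec)
  qed (simp add: \<sigma>_def)
  moreover have "\<sigma> m (v + w) = \<sigma> m v + \<sigma> m w" "\<sigma> m (r \<cdot>\<^sub>v v) = r \<cdot>\<^sub>v \<sigma> m v" "\<sigma> m v \<in> carrier_vec (Suc d)"
    if "v \<in> carrier_vec (Suc d)" "w \<in> carrier_vec (Suc d)" for v w r
    using that mod_le by (auto simp: \<sigma>_def less_Suc_eq_le)
  ultimately show ?thesis
    unfolding affine_map_vec isomorphic_pairs_vec_iff by (intro exI[of _ "\<sigma> m"]) auto
qed

section \<open>The two families in cyclic form\<close>

lemma CBP_root_eq: "CBP_root d q \<epsilon> = (circ_mat d (\<lambda>i. inverse (q ^ i) * \<epsilon>) 1, diag_seq_mat d (\<lambda>i. q ^ i))"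
proof -
  have "fst (CBP_root d q \<epsilon>) = circ_mat d (\<lambda>i. inverse (q ^ i) * \<epsilon>) 1"
    by (intro eq_matI) (auto simp: CBP_root_def circ_mat_def pred_mod)
  then show ?thesis by (simp add: CBP_root_def diag_seq_mat_def prod_eq_iff)
qed

lemma CBP_char_eq: "CBP_char d \<gamma> = (circ_mat d (\<lambda>i. of_nat i + \<gamma>) 0, diag_seq_mat d of_nat)"
proof -
  have "fst (CBP_char d \<gamma>) = circ_mat d (\<lambda>i. of_nat i + \<gamma>) 0"
    by (intro eq_matI) (auto simp: CBP_char_def circ_mat_def pred_mod)
  then show ?thesis by (simp add: CBP_char_def diag_seq_mat_def prod_eq_iff)
qed

text \<open>The ladders supply the circular bidiagonal property of both pairs, so that only the
  search for scalars and an isomorphism remains.\<close>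

lemma affine_equivalent_ladder_iff:
  assumes "eigen_ladder d a \<theta> eig c" "eigen_ladder d a' \<theta>' eig' c'"
  shows "mat_affine_equivalent d (circ_mat d a (eig 0), diag_seq_mat d \<theta>)
      (circ_mat d a' (eig' 0), diag_seq_mat d \<theta>') \<longleftrightarrow>
    (\<exists>s t ss ts. s \<noteq> 0 \<and> ss \<noteq> 0 \<and> isomorphic_pairs (module_vec TYPE('a::field) (d + 1))
      (affine_map (module_vec TYPE('a) (d + 1)) s t (\<lambda>v. circ_mat d a (eig 0) *\<^sub>v v))
      (affine_map (module_vec TYPE('a) (d + 1)) ss ts (\<lambda>v. diag_seq_mat d \<theta> *\<^sub>v v))
      (module_vec TYPE('a) (d + 1)) (\<lambda>v. circ_mat d a' (eig' 0) *\<^sub>v v) (\<lambda>v. diag_seq_mat d \<theta>' *\<^sub>v v))"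
  using eigen_ladder.circular_bidiagonal_pair[OF assms(1)] eigen_ladder.circular_bidiagonal_pair[OF assms(2)]
  by (simp add: mat_affine_equivalent_def affine_equivalent_def eigen_ladder.A_def[OF assms(1)]
      eigen_ladder.As_def[OF assms(1)] eigen_ladder.A_def[OF assms(2)] eigen_ladder.As_def[OF assms(2)])

lemma isomorphic_pairs_swap:
  "isomorphic_pairs V F G W F' G' \<Longrightarrow> isomorphic_pairs V G F W G' F'"
  unfolding isomorphic_pairs_def by blast

text \<open>This is the input that the transported relation cannot give. One eigenvector of each map
  is followed: the all-ones vector for \<open>A\<close> and the first unit vector for
  \<open>As\<close>.\<close>

lemma affine_ladder_eigenvalues:
  fixes a \<theta> a' \<theta>' :: "nat \<Rightarrow> 'a::field"
  assumes L: "eigen_ladder d a \<theta> eig c" and L': "eigen_ladder d a' \<theta>' eig' c'"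
    and iso: "isomorphic_pairs (module_vec TYPE('a::field) (d + 1))
      (affine_map (module_vec TYPE('a) (d + 1)) s t (\<lambda>v. circ_mat d a (eig 0) *\<^sub>v v))
      (affine_map (module_vec TYPE('a) (d + 1)) ss ts (\<lambda>v. diag_seq_mat d \<theta> *\<^sub>v v))
      (module_vec TYPE('a) (d + 1)) (\<lambda>v. circ_mat d a' (eig' 0) *\<^sub>v v) (\<lambda>v. diag_seq_mat d \<theta>' *\<^sub>v v)"
  obtains j k where "s * eig 0 + t = eig' j" "ss * \<theta> 0 + ts = \<theta>' k"
proof -
  interpret eigen_ladder d a \<theta> eig c by fact
  interpret L': eigen_ladder d a' \<theta>' eig' c' by fact
  have "A *\<^sub>v u 0 = eig 0 \<cdot>\<^sub>v u 0"
  proof (rule eq_vecI)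
    fix i assume "i < dim_vec (eig 0 \<cdot>\<^sub>v u 0)"
    then show "(A *\<^sub>v u 0) $ i = (eig 0 \<cdot>\<^sub>v u 0) $ i"
      using A_u[of i 0] by (simp add: u_def del: index_mult_mat_vec)
  qed (simp add: A_def u_def)
  moreover have "u 0 \<noteq> 0\<^sub>v (d + 1)" using u_nonzero[of 0 0] by auto
  ultimately obtain w where w: "w \<in> carrier_vec (d + 1)" "w \<noteq> 0\<^sub>v (d + 1)"
      "L'.A *\<^sub>v w = (s * eig 0 + t) \<cdot>\<^sub>v w"
    using affine_isomorphic_eigenvector[OF iso, of "u 0" "eig 0"] unfolding A_def L'.A_def by auto
  obtain j where j: "s * eig 0 + t = eig' j" using L'.eigenvalue_A[of w] w by auto
  have "As *\<^sub>v unit_vec (Suc d) 0 = \<theta> 0 \<cdot>\<^sub>v unit_vec (Suc d) 0"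
  proof (rule eq_vecI)
    fix i assume "i < dim_vec (\<theta> 0 \<cdot>\<^sub>v unit_vec (Suc d) 0)"
    then show "(As *\<^sub>v unit_vec (Suc d) 0) $ i = (\<theta> 0 \<cdot>\<^sub>v unit_vec (Suc d) 0) $ i"
      by (simp add: As_def diag_seq_mat_mult_index del: index_mult_mat_vec)
  qed (simp add: As_def)
  moreover have "unit_vec (Suc d) 0 \<noteq> (0\<^sub>v (d + 1) :: 'a vec)" by simp
  ultimately obtain w where w: "w \<in> carrier_vec (d + 1)" "w \<noteq> 0\<^sub>v (d + 1)"
      "L'.As *\<^sub>v w = (ss * \<theta> 0 + ts) \<cdot>\<^sub>v w"
    using affine_isomorphic_eigenvector[OF isomorphic_pairs_swap[OF iso], of "unit_vec (Suc d) 0" "\<theta> 0"]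
    unfolding As_def L'.As_def by auto
  obtain k where k: "ss * \<theta> 0 + ts = \<theta>' k" using L'.eigenvalue_As[of w] w by auto
  show thesis using that j k by blast
qed

section \<open>Ladders from roots of unity and from the prime field\<close>

lemma primitive_root_power_mod:
  assumes "primitive_root_of_unity (Suc d) q"
  shows "q ^ (m mod Suc d) = q ^ m"
proof -
  have "q ^ m = q ^ (Suc d * (m div Suc d) + m mod Suc d)" by (simp only: mult_div_mod_eq)
  also have "\<dots> = q ^ (m mod Suc d)"
    using assms unfolding primitive_root_of_unity_def power_add power_mult by simp
  finally show ?thesis by simp
qed

lemma primitive_root_inverse:
  fixes q :: "'a::field"
  assumes "primitive_root_of_unity (Suc d) q"
  shows "q \<noteq> 0" "q ^ d = inverse q"
proof -
  have "q * q ^ d = 1" using assms by (simp add: primitive_root_of_unity_def)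
  then show "q \<noteq> 0" "q ^ d = inverse q" using inverse_unique[of q "q ^ d"] by auto
qed

lemma primitive_root_power_mem:
  fixes q :: "'a::field"
  assumes "primitive_root_of_unity (Suc d) q"
  shows "q ^ m \<in> {q ^ i | i. i \<le> d}"
  using primitive_root_power_mod[OF assms, of m] mod_less_divisor[of "Suc d" m]
  by (intro CollectI exI[of _ "m mod Suc d"]) simp

lemma primitive_root_inj:
  fixes q :: "'a::field"
  assumes q: "primitive_root_of_unity (Suc d) q"
  shows "inj_on (\<lambda>k. q ^ k) {..d}"
proof (rule linorder_inj_onI)
  fix x y assume xy: "x < y" "x \<in> {..d}" "y \<in> {..d}"
  then have "q ^ (y - x) \<noteq> 1" using q by (auto simp: primitive_root_of_unity_def)
  moreover have "q ^ y = q ^ x * q ^ (y - x)" using xy by (simp flip: power_add)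
  ultimately show "q ^ x \<noteq> q ^ y" using primitive_root_inverse[OF q] by auto
qed auto

text \<open>If \<open>A w = \<lambda> w\<close>, the relation
  \<open>q A As - As A = (q - 1) \<epsilon> I\<close> makes \<open>(As - c) w\<close> satisfy the
  eigenvector equation for \<open>\<lambda> / q\<close> as soon as
  \<open>c * \<lambda> = \<epsilon>\<close>. Starting from eigenvalue 1, this yields the eigenvalues
  \<open>inverse (q ^ k)\<close> and the shifts \<open>\<epsilon> * q ^ k\<close>. That no shift
  equals an entry of \<open>As\<close> is the condition on \<open>\<epsilon>\<close>.\<close>

lemma eigen_ladder_root:
  fixes q \<epsilon> :: "'a::field"
  assumes d: "1 \<le> d" and q: "primitive_root_of_unity (Suc d) q" and \<epsilon>: "\<epsilon> \<notin> {q ^ i | i. i \<le> d}"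
  shows "eigen_ladder d (\<lambda>i. inverse (q ^ i) * \<epsilon>) (\<lambda>i. q ^ i) (\<lambda>k. inverse (q ^ k)) (\<lambda>k. \<epsilon> * q ^ k)"
proof
  note [simp] = primitive_root_power_mod[OF q] primitive_root_inverse[OF q]
  show "1 \<le> d" by fact
  show "inverse (q ^ i) * \<epsilon> * (q ^ i - q ^ ((i + d) mod Suc d)) + (q ^ ((i + d) mod Suc d) - \<epsilon> * q ^ k) * inverse (q ^ k)
      = inverse (q ^ Suc k) * (q ^ i - \<epsilon> * q ^ k)" for i k
    by (simp add: power_add field_simps)
  show "inverse (q ^ Suc d) = inverse (q ^ 0)" by simp
  show "inj_on (\<lambda>k. inverse (q ^ k)) {..d}"
    using primitive_root_inj[OF q] by (simp add: inj_on_def)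
  show "q ^ i \<noteq> \<epsilon> * q ^ k" for i k
  proof
    assume "q ^ i = \<epsilon> * q ^ k"
    then have "\<epsilon> = q ^ (i + d * k)" by (simp add: power_add power_mult power_inverse field_simps)
    then show False using \<epsilon> primitive_root_power_mem[OF q, of "i + d * k"] by (simp only: not_True_eq_False)
  qed
  show "inverse (q ^ i) * \<epsilon> \<noteq> inverse (q ^ 0)" if "i \<le> d" for i
    using \<epsilon> that by (auto simp: field_simps)
qed

lemma of_nat_mod_CHAR:
  assumes "CHAR('a::field) = Suc d"
  shows "(of_nat (m mod Suc d) :: 'a) = of_nat m"
  using assms by (simp add: of_nat_eq_iff_cong_CHAR cong_def)

lemma of_nat_diff_mem_CHAR:
  assumes "CHAR('a::field) = Suc d"
  shows "(of_nat k - of_nat l :: 'a) \<in> {of_nat i | i. i \<le> d}"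
proof -
  have n0: "(of_nat (Suc d) :: 'a) = 0" using of_nat_CHAR[where 'a = 'a] assms by simp
  \<comment> \<open>Since \<open>d = -1\<close> in characteristic \<open>d + 1\<close>, adding
    \<open>d * l\<close> subtracts \<open>l\<close> without leaving the natural numbers.\<close>
  have "(of_nat (k + d * l) :: 'a) = of_nat k + (of_nat (Suc d) - 1) * of_nat l" by simp
  also have "\<dots> = of_nat k - of_nat l" unfolding n0 by simp
  finally show ?thesis
    using of_nat_mod_CHAR[OF assms, of "k + d * l"] mod_less_divisor[of "Suc d" "k + d * l"]
    by (intro CollectI exI[of _ "(k + d * l) mod Suc d"]) simp
qed

text \<open>If \<open>A w = \<lambda> w\<close>, the relation
  \<open>As A - A As - A + As + \<gamma> I = 0\<close> makes \<open>(As - c) w\<close> satisfy the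
  eigenvector equation for \<open>\<lambda> + 1\<close> when
  \<open>c = \<lambda> - \<gamma>\<close>. Starting from 0, the eigenvalues run through the prime
  field and return to 0 because the characteristic is \<open>d + 1\<close>.\<close>

lemma eigen_ladder_char:
  fixes \<gamma> :: "'a::field"
  assumes d: "1 \<le> d" and char: "CHAR('a) = Suc d" and \<gamma>: "\<gamma> \<notin> {of_nat i | i. i \<le> d}"
  shows "eigen_ladder d (\<lambda>i. of_nat i + \<gamma>) of_nat of_nat (\<lambda>k. of_nat k - \<gamma>)"
proof
  have n0: "(of_nat (Suc d) :: 'a) = 0" using of_nat_CHAR[where 'a = 'a] char by simp
  have p: "(of_nat ((i + d) mod Suc d) :: 'a) = of_nat i - 1" for i
    using n0 unfolding of_nat_mod_CHAR[OF char] by (simp add: algebra_simps eq_neg_iff_add_eq_0)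
  show "1 \<le> d" by fact
  show "(of_nat i + \<gamma>) * (of_nat i - of_nat ((i + d) mod Suc d))
      + (of_nat ((i + d) mod Suc d) - (of_nat k - \<gamma>)) * of_nat k
      = of_nat (Suc k) * (of_nat i - (of_nat k - \<gamma>))" for i k
    unfolding p by (simp add: algebra_simps)
  show "(of_nat (Suc d) :: 'a) = of_nat 0" unfolding n0 by simp
  show "inj_on (of_nat :: nat \<Rightarrow> 'a) {..d}"
    using char by (auto simp: inj_on_def of_nat_eq_iff_cong_CHAR cong_def)
  show "of_nat i \<noteq> of_nat k - \<gamma>" for i k
  proof
    assume "of_nat i = of_nat k - \<gamma>"
    then have "\<gamma> = of_nat k - of_nat i" by simp
    then show False using \<gamma> of_nat_diff_mem_CHAR[OF char, of k i] by (simp only: not_True_eq_False)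
  qed
  show "of_nat i + \<gamma> \<noteq> of_nat 0" for i
  proof
    assume "of_nat i + \<gamma> = of_nat 0"
    then have "\<gamma> = of_nat 0 - of_nat i" by (simp add: eq_neg_iff_add_eq_0 add.commute)
    then show False using \<gamma> of_nat_diff_mem_CHAR[OF char, of 0 i] by (simp only: not_True_eq_False)
  qed
qed

section \<open>Affine equivalence within each family\<close>

lemma CBP_root_affine_equivalent_iff:
  fixes q \<epsilon> q' \<epsilon>' :: "'a::field"
  assumes d: "1 \<le> d"
    and q: "primitive_root_of_unity (Suc d) q" and \<epsilon>: "\<epsilon> \<notin> {q ^ i | i. i \<le> d}"
    and q': "primitive_root_of_unity (Suc d) q'" and \<epsilon>': "\<epsilon>' \<notin> {q' ^ i | i. i \<le> d}"
  shows "mat_affine_equivalent d (CBP_root d q \<epsilon>) (CBP_root d q' \<epsilon>') \<longleftrightarrow>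
      q = q' \<and> \<epsilon>' \<in> {q ^ i * \<epsilon> | i. i \<le> d}" (is "?L \<longleftrightarrow> ?R")
proof -
  note L = eigen_ladder_root[OF d q \<epsilon>] and L' = eigen_ladder_root[OF d q' \<epsilon>']
  have equiv: "?L \<longleftrightarrow> (\<exists>s t ss ts. s \<noteq> 0 \<and> ss \<noteq> 0 \<and> isomorphic_pairs (module_vec TYPE('a::field) (d + 1))
      (affine_map (module_vec TYPE('a) (d + 1)) s t (\<lambda>v. circ_mat d (\<lambda>i. inverse (q ^ i) * \<epsilon>) 1 *\<^sub>v v))
      (affine_map (module_vec TYPE('a) (d + 1)) ss ts (\<lambda>v. diag_seq_mat d (\<lambda>i. q ^ i) *\<^sub>v v))
      (module_vec TYPE('a) (d + 1)) (\<lambda>v. circ_mat d (\<lambda>i. inverse (q' ^ i) * \<epsilon>') 1 *\<^sub>v v)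
      (\<lambda>v. diag_seq_mat d (\<lambda>i. q' ^ i) *\<^sub>v v))"
    using affine_equivalent_ladder_iff[OF L L'] by (simp add: CBP_root_eq)
  note pm = primitive_root_power_mod[OF q] and pm' = primitive_root_power_mod[OF q']
  note iq = primitive_root_inverse[OF q] and iq' = primitive_root_inverse[OF q']
  have q1: "q \<noteq> 1" using q d by (auto simp: primitive_root_of_unity_def elim!: allE[of _ 1])
  show ?thesis
  proof
    assume ?L
    then obtain s t ss ts where s: "s \<noteq> 0" "ss \<noteq> 0" and iso: "isomorphic_pairs (module_vec TYPE('a::field) (d + 1))
      (affine_map (module_vec TYPE('a) (d + 1)) s t (\<lambda>v. circ_mat d (\<lambda>i. inverse (q ^ i) * \<epsilon>) 1 *\<^sub>v v))
      (affine_map (module_vec TYPE('a) (d + 1)) ss ts (\<lambda>v. diag_seq_mat d (\<lambda>i. q ^ i) *\<^sub>v v))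
      (module_vec TYPE('a) (d + 1)) (\<lambda>v. circ_mat d (\<lambda>i. inverse (q' ^ i) * \<epsilon>') 1 *\<^sub>v v)
      (\<lambda>v. diag_seq_mat d (\<lambda>i. q' ^ i) *\<^sub>v v)"
      unfolding equiv by blast
    have a: "inverse (q ^ i) * \<epsilon> \<noteq> 1" if "i \<le> d" for i
      using eigen_ladder.a_neq[OF L that] by simp
    \<comment> \<open>The coefficients \<open>q'\<close>, \<open>-1\<close>, \<open>0\<close>,
      \<open>0\<close>, \<open>-\<epsilon>' * (q' - 1)\<close> encode
      \<open>q' B Bs - Bs B = (q' - 1) \<epsilon>' I\<close> for the target pair \<open>B\<close>,
      \<open>Bs\<close>.\<close>
    have off': "q' * q' ^ ((i + d) mod Suc d) + (- 1) * q' ^ i + 0 = 0" for i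
      using iq' by (simp add: pm' power_add)
    have diag': "(q' + - 1) * (inverse (q' ^ i) * \<epsilon>') * q' ^ i + 0 * (inverse (q' ^ i) * \<epsilon>') + 0 * q' ^ i
        + (- \<epsilon>' * (q' - 1)) = 0" for i
      using iq' by (simp add: field_simps)
    note rel = affine_circ_relation[OF d s(1) _ iso]
    have off: "q' * (ss * (q ^ i * inverse q) + ts) - (ss * q ^ i + ts) = 0" if "i \<le> d" for i
    proof -
      have "q' * (ss * q ^ ((i + d) mod Suc d) + ts) + (- 1) * (ss * q ^ i + ts) + 0 = 0"
        by (rule rel(1)) (erule a, rule off', rule diag', rule that)
      then show ?thesis by (simp add: pm power_add iq algebra_simps)
    qed
    have diag: "(q' - 1) * (s * (inverse (q ^ i) * \<epsilon>) + t) * (ss * q ^ i + ts) = \<epsilon>' * (q' - 1)"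
      if "i \<le> d" for i
    proof -
      have "(q' + - 1) * (s * (inverse (q ^ i) * \<epsilon>) + t) * (ss * q ^ i + ts)
          + 0 * (s * (inverse (q ^ i) * \<epsilon>) + t) + 0 * (ss * q ^ i + ts) + (- \<epsilon>' * (q' - 1)) = 0"
        by (rule rel(2)) (erule a, rule off', rule diag', rule that)
      then show ?thesis by simp
    qed
    \<comment> \<open>Subtracting the equations of two consecutive rows removes \<open>ts\<close>
      and forces \<open>q' = q\<close>; either row then gives \<open>ts = 0\<close>.\<close>
    have o0: "q' * (ss * inverse q + ts) = ss + ts" and o1: "q' * (ss + ts) = ss * q + ts"
      using off[of 0] off[of 1] d iq by simp_all
    have "q' * ss * (1 - inverse q) = q' * (ss + ts) - q' * (ss * inverse q + ts)"
      by (simp add: algebra_simps)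
    also have "\<dots> = ss * (q - 1)" unfolding o0 o1 by (simp add: algebra_simps)
    finally have "q' * ss * (1 - inverse q) = ss * (q - 1)" .
    then have "(q' - q) * ((q - 1) * ss) = 0" using iq by (simp add: field_simps)
    then have qq: "q' = q" using q1 s by simp
    then have "(q - 1) * ts = 0" using o1 by (simp add: algebra_simps)
    then have ts: "ts = 0" using q1 by simp
    have d0: "(s * \<epsilon> + t) * ss = \<epsilon>'" using diag[of 0] q1 by (simp add: ts qq)
    have d1: "(s * (inverse q * \<epsilon>) + t) * (ss * q) = \<epsilon>'" using diag[of 1] d q1 by (simp add: ts qq)
    \<comment> \<open>Rows 0 and 1 of the diagonal have the same value; the contribution of
      \<open>s\<close> is the same in both, so their difference isolates \<open>t\<close>.\<close>
    have "(q - 1) * (t * ss) = (s * (inverse q * \<epsilon>) + t) * (ss * q) - (s * \<epsilon> + t) * ss"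
      using iq(1) by (simp add: algebra_simps)
    then have "(q - 1) * (t * ss) = 0" unfolding d0 d1 by simp
    then have t: "t = 0" using q1 s by simp
    \<comment> \<open>Only \<open>\<epsilon>' = s * ss * \<epsilon>\<close> is left. With
      \<open>t = ts = 0\<close>, the spectra make both scalars powers of \<open>q\<close>.\<close>
    obtain j k where "s = inverse (q ^ j)" "ss = q ^ k"
      using affine_ladder_eigenvalues[OF L L', of s t ss ts] iso by (auto simp: t ts qq)
    then have "s * ss = q ^ (d * j + k)" by (simp add: power_add power_mult iq power_inverse)
    then have "\<epsilon>' = q ^ (d * j + k) * \<epsilon>" using d0 by (simp add: t algebra_simps)
    then show ?R using qq primitive_root_power_mem[OF q, of "d * j + k"] by auto
  next
    assume ?R
    then obtain m where qq: "q' = q" and m: "m \<le> d" "\<epsilon>' = q ^ m * \<epsilon>" by blast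
    \<comment> \<open>Rotation by \<open>-m\<close>, reduced modulo \<open>Suc d\<close> because
      \<open>m = 0\<close> would give \<open>Suc d\<close>. It multiplies the diagonal of
      \<open>A\<close> by \<open>q ^ m\<close>, as wanted, and that of \<open>As\<close> by the
      inverse, which the choice \<open>ss = q ^ m\<close> compensates.\<close>
    define k where "k = (Suc d - m) mod Suc d"
    have k: "k \<le> d" using mod_less_divisor[of "Suc d"] by (simp add: k_def less_Suc_eq_le)
    have "q ^ k * q ^ m = q ^ (Suc d)" using m by (simp add: k_def pm flip: power_add)
    also have "\<dots> = 1" using q by (simp add: primitive_root_of_unity_def)
    finally have km: "q ^ m * q ^ k = 1" by (simp add: mult.commute)
    then have ik: "inverse (q ^ k) = q ^ m" by (metis inverse_unique mult.commute)
    have a': "inverse (q' ^ i) * \<epsilon>' = inverse (q ^ ((i + k) mod Suc d)) * \<epsilon>" for i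
      by (simp add: pm qq m power_add ik)
    have th': "q' ^ i = q ^ m * q ^ ((i + k) mod Suc d) + 0" for i
      using km by (simp add: pm qq power_add mult.left_commute)
    have "q ^ m \<noteq> 0" using iq by simp
    then show ?L unfolding equiv
      by (intro exI[of _ 1] exI[of _ 0] exI[of _ "q ^ m"] conjI shift_isomorphic_pairs[OF d k] a' th') auto
  qed
qed

lemma CBP_char_affine_equivalent_iff:
  fixes \<gamma> \<gamma>' :: "'a::field"
  assumes d: "1 \<le> d" and char: "CHAR('a) = Suc d"
    and \<gamma>: "\<gamma> \<notin> {of_nat i | i. i \<le> d}" and \<gamma>': "\<gamma>' \<notin> {of_nat i | i. i \<le> d}"
  shows "mat_affine_equivalent d (CBP_char d \<gamma>) (CBP_char d \<gamma>') \<longleftrightarrow>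
      \<gamma>' - \<gamma> \<in> {of_nat i | i. i \<le> d}" (is "?L \<longleftrightarrow> ?R")
proof -
  note L = eigen_ladder_char[OF d char \<gamma>] and L' = eigen_ladder_char[OF d char \<gamma>']
  have equiv: "?L \<longleftrightarrow> (\<exists>s t ss ts. s \<noteq> 0 \<and> ss \<noteq> 0 \<and> isomorphic_pairs (module_vec TYPE('a::field) (d + 1))
      (affine_map (module_vec TYPE('a) (d + 1)) s t (\<lambda>v. circ_mat d (\<lambda>i. of_nat i + \<gamma>) 0 *\<^sub>v v))
      (affine_map (module_vec TYPE('a) (d + 1)) ss ts (\<lambda>v. diag_seq_mat d of_nat *\<^sub>v v))
      (module_vec TYPE('a) (d + 1)) (\<lambda>v. circ_mat d (\<lambda>i. of_nat i + \<gamma>') 0 *\<^sub>v v)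
      (\<lambda>v. diag_seq_mat d of_nat *\<^sub>v v))"
    using affine_equivalent_ladder_iff[OF L L'] by (simp add: CBP_char_eq)
  have n0: "(of_nat (Suc d) :: 'a) = 0" using of_nat_CHAR[where 'a = 'a] char by simp
  have p: "(of_nat ((i + d) mod Suc d) :: 'a) = of_nat i - 1" for i
    using n0 unfolding of_nat_mod_CHAR[OF char] by (simp add: algebra_simps eq_neg_iff_add_eq_0)
  show ?thesis
  proof
    assume ?L
    then obtain s t ss ts where s: "s \<noteq> 0" "ss \<noteq> 0" and iso: "isomorphic_pairs (module_vec TYPE('a::field) (d + 1))
      (affine_map (module_vec TYPE('a) (d + 1)) s t (\<lambda>v. circ_mat d (\<lambda>i. of_nat i + \<gamma>) 0 *\<^sub>v v))
      (affine_map (module_vec TYPE('a) (d + 1)) ss ts (\<lambda>v. diag_seq_mat d of_nat *\<^sub>v v))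
      (module_vec TYPE('a) (d + 1)) (\<lambda>v. circ_mat d (\<lambda>i. of_nat i + \<gamma>') 0 *\<^sub>v v)
      (\<lambda>v. diag_seq_mat d of_nat *\<^sub>v v)"
      unfolding equiv by blast
    have a: "of_nat i + \<gamma> \<noteq> 0" if "i \<le> d" for i
      using eigen_ladder.a_neq[OF L that] by simp
    \<comment> \<open>The coefficients \<open>-1\<close>, \<open>1\<close>, \<open>-1\<close>,
      \<open>1\<close>, \<open>\<gamma>'\<close> encode
      \<open>Bs B - B Bs - B + Bs + \<gamma>' I = 0\<close> for the target pair.\<close>
    have off': "(- 1) * of_nat ((i + d) mod Suc d) + 1 * of_nat i + (- 1) = (0::'a)" for i
      unfolding p by simp
    have diag': "(- 1 + 1) * (of_nat i + \<gamma>') * of_nat i + (- 1) * (of_nat i + \<gamma>') + 1 * of_nat i + \<gamma>' = 0" for i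
      by simp
    note rel = affine_circ_relation[OF d s(1) _ iso]
    have off: "(- 1) * (ss * of_nat ((i + d) mod Suc d) + ts) + 1 * (ss * of_nat i + ts) + (- 1) = 0"
      if "i \<le> d" for i
      by (rule rel(1)) (erule a, rule off', rule diag', rule that)
    have diag: "(- 1 + 1) * (s * (of_nat i + \<gamma>) + t) * (ss * of_nat i + ts)
        + (- 1) * (s * (of_nat i + \<gamma>) + t) + 1 * (ss * of_nat i + ts) + \<gamma>' = 0"
      if "i \<le> d" for i
      by (rule rel(2)) (erule a, rule off', rule diag', rule that)
    have ss: "ss = 1" using off[of 1] d unfolding p by simp
    have d0: "ts + \<gamma>' = s * \<gamma> + t" using diag[of 0] by (simp add: algebra_simps)
    have "s * (1 + \<gamma>) + t = 1 + (ts + \<gamma>')" using diag[of 1] d by (simp add: ss algebra_simps)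
    then have s1: "s = 1" unfolding d0 by (simp add: algebra_simps)
    \<comment> \<open>With \<open>s = ss = 1\<close> only
      \<open>\<gamma>' - \<gamma> = t - ts\<close> is left. The followed eigenvalues are both 0, so
      \<open>t\<close> and \<open>ts\<close> themselves are eigenvalues of the target maps.\<close>
    obtain j k where "t = of_nat j" "ts = of_nat k"
      using affine_ladder_eigenvalues[OF L L', of s t ss ts] iso by auto
    then have "\<gamma>' - \<gamma> = of_nat j - of_nat k" using d0 by (simp add: s1 algebra_simps)
    then show ?R using of_nat_diff_mem_CHAR[OF char, of j k] by simp
  next
    assume ?R
    then obtain m where m: "m \<le> d" "\<gamma>' - \<gamma> = of_nat m" by blast
    then have \<gamma>m: "\<gamma>' = \<gamma> + of_nat m" by (simp add: algebra_simps)
    \<comment> \<open>Rotation by \<open>m\<close> adds \<open>m\<close> to both diagonals: on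
      \<open>A\<close> this turns \<open>\<gamma>\<close> into \<open>\<gamma>'\<close>, and on
      \<open>As\<close> it is undone by \<open>ts = - of_nat m\<close>.\<close>
    have a': "of_nat i + \<gamma>' = of_nat ((i + m) mod Suc d) + \<gamma>" for i
      unfolding of_nat_mod_CHAR[OF char] by (simp add: \<gamma>m)
    have th': "of_nat i = 1 * of_nat ((i + m) mod Suc d) + (- of_nat m :: 'a)" for i
      unfolding of_nat_mod_CHAR[OF char] by simp
    show ?L unfolding equiv
      by (intro exI[of _ 1] exI[of _ 0] exI[of _ "- of_nat m"] conjI shift_isomorphic_pairs[OF d m(1)] a' th') auto
  qed
qed

theorem lemma2p17:
  fixes d :: nat
  assumes "d \<ge> 1"
  shows
    "(CHAR('a::field) \<noteq> d + 1 \<longrightarrow>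
       (\<forall>(q::'a) \<epsilon> q' \<epsilon>'.
          primitive_root_of_unity (d + 1) q \<and> \<epsilon> \<notin> {q ^ i | i. i \<le> d} \<and>
          primitive_root_of_unity (d + 1) q' \<and> \<epsilon>' \<notin> {q' ^ i | i. i \<le> d} \<longrightarrow>
          (mat_affine_equivalent d (CBP_root d q \<epsilon>) (CBP_root d q' \<epsilon>') \<longleftrightarrow>
             q = q' \<and> \<epsilon>' \<in> {q ^ i * \<epsilon> | i. i \<le> d}))) \<and>
     (CHAR('a) = d + 1 \<longrightarrow>
       (\<forall>(\<gamma>::'a) \<gamma>'.
          prime (d + 1) \<and> \<gamma> \<notin> {of_nat i | i. i \<le> d} \<and> \<gamma>' \<notin> {of_nat i | i. i \<le> d} \<longrightarrow>
          (mat_affine_equivalent d (CBP_char d \<gamma>) (CBP_char d \<gamma>') \<longleftrightarrow>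
             \<gamma>' - \<gamma> \<in> {of_nat i | i. i \<le> d})))"
proof (intro conjI impI allI, goal_cases)
  case (1 q \<epsilon> q' \<epsilon>')
  then show ?case by (intro CBP_root_affine_equivalent_iff[OF assms]) auto
next
  case (2 \<gamma> \<gamma>')
  then show ?case by (intro CBP_char_affine_equivalent_iff[OF assms]) auto
qed

end
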